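(* The space $\mathcal{S}_c(\mathbb{A})$ of all nontrivial convergent sequences in the double arrow space $\mathbb{A}$, with the (subspace) Vietoris topology, is homogeneous.
   Context: Double arrow space: let $\mathbb{A}_0={]}0,1]\times\{0\}$, $\mathbb{A}_1=[0,1{[}\times\{1\}$ (intervals of reals) and $\mathbb{A}=\mathbb{A}_0\cup\mathbb{A}_1$, ordered lexicographically: $\langle a,r\rangle\prec\langle b,s\rangle$ iff $a<b$, or $a=b$ and $r<s$. $\mathbb{A}$ carries the order topology. Vietoris topology: for a space $X$, $\operatorname{Exp}(X)$ is the set of all non-empty closed subsets of $X$, with the topology generated by the subbase of all sets $[V]=\{F\in\operatorname{Exp}(X):F\subset V\}$ and $\langle V\rangle=\{F\in\operatorname{Exp}(X):F\cap V\neq\emptyset\}$, $V$ a non-empty open subset of $X$. For a Hausdorff space $X$, a set $S\subset X$ is a nontrivial convergent sequence in $X$ if $S$ is countably infinite and there is $x\in S$ such that $S\setminus V$ is finite for every open neighborhood $V$ of $x$. $\mathcal{S}_c(X)\subset\operatorname{Exp}(X)$ is the subspace of all nontrivial convergent sequences in $X$. A topological space $Y$ is homogeneous if for all $x,y\in Y$ there is a homeomorphism $h:Y\to Y$ with $h(x)=y$. *)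

theory Defs
  imports "HOL-Analysis.Analysis"
begin

section \<open>The double arrow space\<close>

typedef double_arrow =
  "({0<..1} \<times> {0}) \<union> ({0..<1} \<times> {1}) :: (real \<times> nat) set"
  by (rule exI[of _ "(1, 0)"]) simp

setup_lifting type_definition_double_arrow

text \<open>The lexicographic order is written out because the order that
  \<^theory>\<open>HOL-Analysis.Analysis\<close> puts on pairs is the componentwise one.\<close>

instantiation double_arrow :: linorder
begin

lift_definition less_double_arrow :: "double_arrow \<Rightarrow> double_arrow \<Rightarrow> bool"
  is "\<lambda>p q. fst p < fst q \<or> (fst p = fst q \<and> snd p < snd q)" .

definition less_eq_double_arrow :: "double_arrow \<Rightarrow> double_arrow \<Rightarrow> bool"
  where "(x::double_arrow) \<le> y \<longleftrightarrow> x < y \<or> x = y"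

instance
proof
  fix x y z :: double_arrow
  have irrefl: "\<not> a < a" for a :: double_arrow
    by transfer simp
  have trans: "a < b \<Longrightarrow> b < c \<Longrightarrow> a < c" for a b c :: double_arrow
    by transfer (metis order.strict_trans)
  have total: "a < b \<or> a = b \<or> b < a" for a b :: double_arrow
    by transfer (metis linorder_neqE prod_eq_iff)
  show "x < y \<longleftrightarrow> x \<le> y \<and> \<not> y \<le> x" "x \<le> x"
    "x \<le> y \<Longrightarrow> y \<le> z \<Longrightarrow> x \<le> z" "x \<le> y \<Longrightarrow> y \<le> x \<Longrightarrow> x = y" "x \<le> y \<or> y \<le> x"
    unfolding less_eq_double_arrow_def using irrefl trans total by metis+
qed

end

text \<open>Membership in the class \<^class>\<open>linorder_topology\<close> says that the open sets
  are those generated by the open rays, i.e. that the topology is the order topology.\<close>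

instantiation double_arrow :: linorder_topology
begin

definition open_double_arrow :: "double_arrow set \<Rightarrow> bool"
  where "open_double_arrow =
    generate_topology (range (\<lambda>a. {..<a}) \<union> range (\<lambda>a. {a<..}))"

instance
  by standard (rule open_double_arrow_def)

end


section \<open>The Vietoris topology\<close>

definition Exp :: "'a topology \<Rightarrow> 'a set set"
  where "Exp X = {F. closedin X F \<and> F \<noteq> {}}"

definition vietoris :: "'a topology \<Rightarrow> 'a set topology"
  where "vietoris X = topology_generated_by
    ({{F \<in> Exp X. F \<subseteq> V} | V. openin X V \<and> V \<noteq> {}} \<union>
     {{F \<in> Exp X. F \<inter> V \<noteq> {}} | V. openin X V \<and> V \<noteq> {}})"

lemma topspace_vietoris: "topspace (vietoris X) = Exp X"
proof
  show "topspace (vietoris X) \<subseteq> Exp X"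
    unfolding vietoris_def topology_generated_by_topspace by blast
  show "Exp X \<subseteq> topspace (vietoris X)"
  proof
    fix F assume F: "F \<in> Exp X"
    then have "F \<subseteq> topspace X" "topspace X \<noteq> {}"
      using closedin_subset by (fastforce simp: Exp_def)+
    with F have "F \<in> {F \<in> Exp X. F \<subseteq> topspace X}" by simp
    with \<open>topspace X \<noteq> {}\<close> openin_topspace show "F \<in> topspace (vietoris X)"
      unfolding vietoris_def topology_generated_by_topspace
      by (intro UnionI[of "{F \<in> Exp X. F \<subseteq> topspace X}"] UnI1) auto
  qed
qed


section \<open>Nontrivial convergent sequences\<close>

definition nontrivial_convergent_sequence :: "'a topology \<Rightarrow> 'a set \<Rightarrow> bool"
  where "nontrivial_convergent_sequence X S \<longleftrightarrow>
    S \<subseteq> topspace X \<and> countable S \<and> infinite S \<and>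
    (\<exists>x\<in>S. \<forall>V. openin X V \<and> x \<in> V \<longrightarrow> finite (S - V))"

definition Sc :: "'a topology \<Rightarrow> 'a set topology"
  where "Sc X = subtopology (vietoris X) {S. nontrivial_convergent_sequence X S}"

text \<open>Passing to the subspace keeps only the sequences that are closed in \<open>X\<close>;
  for Hausdorff \<open>X\<close> this is no restriction.\<close>

lemma closedin_nontrivial_convergent_sequence:
  assumes "Hausdorff_space X" "nontrivial_convergent_sequence X S"
  shows "closedin X S"
proof -
  obtain x where x: "x \<in> S" and fin: "\<And>V. openin X V \<Longrightarrow> x \<in> V \<Longrightarrow> finite (S - V)"
    and S: "S \<subseteq> topspace X"
    using assms(2) by (auto simp: nontrivial_convergent_sequence_def)
  have "\<exists>T. openin X T \<and> y \<in> T \<and> T \<subseteq> topspace X - S" if y: "y \<in> topspace X - S" for y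
  proof -
    obtain U V where UV: "openin X U" "openin X V" "x \<in> U" "y \<in> V" "disjnt U V"
      using assms(1) x y S unfolding Hausdorff_space_def by (metis DiffE subsetD)
    have "closedin X (S - U)"
      using fin[OF UV(1,3)] S assms(1)
      by (meson Diff_subset Hausdorff_imp_t1_space subset_trans t1_space_closedin_finite)
    then have "openin X (V - (S - U))"
      using UV(2) by blast
    moreover have "V - (S - U) \<subseteq> topspace X - S"
      using UV openin_subset by (fastforce simp: disjnt_iff)
    ultimately show ?thesis
      using UV(4) y by blast
  qed
  then have "openin X (topspace X - S)"
    by (subst openin_subopen) blast
  with S show ?thesis by (simp add: closedin_def)
qed

lemma topspace_Sc:
  assumes "Hausdorff_space X"
  shows "topspace (Sc X) = {S. nontrivial_convergent_sequence X S}"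
proof -
  have "S \<in> Exp X" if "nontrivial_convergent_sequence X S" for S
    using closedin_nontrivial_convergent_sequence[OF assms that] that
    by (auto simp: Exp_def nontrivial_convergent_sequence_def)
  then show ?thesis
    unfolding Sc_def topspace_subtopology topspace_vietoris by blast
qed


section \<open>Homogeneous spaces\<close>

definition homogeneous_space :: "'a topology \<Rightarrow> bool"
  where "homogeneous_space Y \<longleftrightarrow>
    (\<forall>x\<in>topspace Y. \<forall>y\<in>topspace Y. \<exists>h. homeomorphic_map Y Y h \<and> h x = y)"

end

theory Submission
  imports Defs
begin

text \<open>
  Any two nontrivial convergent sequences \<open>S\<close>, \<open>T\<close> in the double arrow space are matched by an
  autohomeomorphism of the double arrow space, which then acts on the hyperspace by taking images.
  Write \<open>a\<^sup>-\<close> and \<open>a\<^sup>+\<close> for the points \<open>(a, 0)\<close> and \<open>(a, 1)\<close>. The space is homogeneous: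
  exchanging the clopen intervals \<open>[0\<^sup>+, a\<^sup>-]\<close> and \<open>[a\<^sup>+, 1\<^sup>-]\<close> moves \<open>a\<^sup>+\<close> to \<open>0\<^sup>+\<close>, and the reflection
  exchanges the two kinds of points. So we may assume that both limits are \<open>0\<^sup>+\<close>. Then there are reals
  \<open>1 = c\<^sub>0 > c\<^sub>1 > \<dots>\<close> such that the intervals \<open>[c\<^sub>n\<^sub>+\<^sub>1\<^sup>+, c\<^sub>n\<^sup>-]\<close> partition the complement of \<open>0\<^sup>+\<close>, shrink
  to \<open>0\<^sup>+\<close> and contain exactly one point of \<open>S\<close> each; likewise for \<open>T\<close>. Each of these intervals is
  an affine copy of the whole space, hence homogeneous, so the \<open>n\<close>-th intervals are homeomorphic by a map
  respecting the chosen points, and these maps glue together.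
\<close>

section \<open>Images of convergent sequences\<close>

lemma image_mem_Exp:
  assumes "homeomorphic_map X Y f" "F \<in> Exp X"
  shows "f ` F \<in> Exp Y"
proof -
  have "closedin X F" "F \<noteq> {}"
    using assms(2) by (auto simp: Exp_def)
  then show ?thesis
    using homeomorphic_map_closedness[OF assms(1) closedin_subset] by (auto simp: Exp_def)
qed

text \<open>The preimage of a subbasic set is the subbasic set of the same kind given by the
  preimage of \<open>V\<close> under \<open>f\<close>, so it suffices to treat the two kinds of
  generators.\<close>

lemma continuous_map_vietoris_image:
  assumes "homeomorphic_map X Y f"
  shows "continuous_map (vietoris X) (vietoris Y) ((`) f)"
  unfolding vietoris_def[of Y]
proof (rule continuous_on_generated_topo)
  have surj: "f ` topspace X = topspace Y" and cont: "continuous_map X Y f"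
    using assms by (auto simp: homeomorphic_eq_everything_map)
  fix \<U>
  assume "\<U> \<in> {{F \<in> Exp Y. F \<subseteq> V} | V. openin Y V \<and> V \<noteq> {}} \<union>
    {{F \<in> Exp Y. F \<inter> V \<noteq> {}} | V. openin Y V \<and> V \<noteq> {}}"
  then obtain V where V: "openin Y V" "V \<noteq> {}"
    and \<U>: "\<U> = {F \<in> Exp Y. F \<subseteq> V} \<or> \<U> = {F \<in> Exp Y. F \<inter> V \<noteq> {}}"
    by blast
  define W where "W = {x \<in> topspace X. f x \<in> V}"
  have "openin X W"
    unfolding W_def using openin_continuous_map_preimage[OF cont V(1)] .
  \<comment> \<open>Surjectivity of \<open>f\<close> makes \<open>W\<close> nonempty, as the subbase
    demands.\<close>
  moreover have "f ` W = V"
    using openin_subset[OF V(1)] surj by (auto simp: W_def)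
  ultimately have W: "openin X W" "W \<noteq> {}"
    using V(2) by auto
  have sub: "F \<subseteq> topspace X" if "F \<in> Exp X" for F
    using that closedin_subset by (auto simp: Exp_def)
  have vim: "(`) f -` \<A> \<inter> Exp X = {F \<in> Exp X. P F}"
    if "\<And>F. F \<in> Exp X \<Longrightarrow> f ` F \<in> \<A> \<longleftrightarrow> P F" for \<A> P
    using that by auto
  have iff: "f ` F \<in> {F \<in> Exp Y. F \<subseteq> V} \<longleftrightarrow> F \<subseteq> W"
    "f ` F \<in> {F \<in> Exp Y. F \<inter> V \<noteq> {}} \<longleftrightarrow> F \<inter> W \<noteq> {}" if "F \<in> Exp X" for F
    using sub[OF that] image_mem_Exp[OF assms that] by (auto simp: W_def)
  have "(`) f -` {F \<in> Exp Y. F \<subseteq> V} \<inter> Exp X = {F \<in> Exp X. F \<subseteq> W}"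
    "(`) f -` {F \<in> Exp Y. F \<inter> V \<noteq> {}} \<inter> Exp X = {F \<in> Exp X. F \<inter> W \<noteq> {}}"
    by (rule vim[OF iff(1)] vim[OF iff(2)], assumption)+
  moreover have "openin (vietoris X) {F \<in> Exp X. F \<subseteq> W}"
    unfolding vietoris_def using W
    by (intro topology_generated_by_Basis UnI1 CollectI exI[of _ W]) simp
  moreover have "openin (vietoris X) {F \<in> Exp X. F \<inter> W \<noteq> {}}"
    unfolding vietoris_def using W
    by (intro topology_generated_by_Basis UnI2 CollectI exI[of _ W]) simp
  ultimately show "openin (vietoris X) ((`) f -` \<U> \<inter> topspace (vietoris X))"
    using \<U> by (elim disjE) (simp_all only: topspace_vietoris)
next
  have "(`) f ` topspace (vietoris X) \<subseteq> topspace (vietoris Y)"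
    using image_mem_Exp[OF assms] by (auto simp: topspace_vietoris)
  then show "(`) f ` topspace (vietoris X) \<subseteq> \<Union> ({{F \<in> Exp Y. F \<subseteq> V} | V. openin Y V \<and> V \<noteq> {}} \<union>
    {{F \<in> Exp Y. F \<inter> V \<noteq> {}} | V. openin Y V \<and> V \<noteq> {}})"
    by (simp only: vietoris_def[of Y] topology_generated_by_topspace)
qed

lemma finite_image_Diff_open:
  assumes cont: "continuous_map X Y f" and sub: "S \<subseteq> topspace X" and x: "x \<in> S"
    and fin: "\<And>V. openin X V \<Longrightarrow> x \<in> V \<Longrightarrow> finite (S - V)"
    and V: "openin Y V" "f x \<in> V"
  shows "finite (f ` S - V)"
proof -
  have "finite (S - {x \<in> topspace X. f x \<in> V})"
    using openin_continuous_map_preimage[OF cont V(1)] V x sub by (intro fin) auto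
  moreover have "f ` S - V \<subseteq> f ` (S - {x \<in> topspace X. f x \<in> V})"
    by auto
  ultimately show ?thesis
    by (meson finite_imageI finite_subset)
qed

lemma nontrivial_convergent_sequence_image:
  assumes f: "homeomorphic_map X Y f" and S: "nontrivial_convergent_sequence X S"
  shows "nontrivial_convergent_sequence Y (f ` S)"
proof -
  have surj: "f ` topspace X = topspace Y" and cont: "continuous_map X Y f"
    and inj: "inj_on f (topspace X)"
    using f by (auto simp: homeomorphic_eq_everything_map)
  obtain x where x: "x \<in> S" and fin: "\<And>V. openin X V \<Longrightarrow> x \<in> V \<Longrightarrow> finite (S - V)"
    and sub: "S \<subseteq> topspace X" and inf: "infinite S" and count: "countable S"
    using S by (auto simp: nontrivial_convergent_sequence_def)
  have "finite (f ` S - V)" if "openin Y V" "f x \<in> V" for V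
    using cont sub x fin that by (rule finite_image_Diff_open)
  moreover have "infinite (f ` S)"
    using inf inj sub by (meson finite_imageD inj_on_subset)
  ultimately show ?thesis
    using x sub surj count unfolding nontrivial_convergent_sequence_def by blast
qed

lemma continuous_map_Sc_image:
  assumes "homeomorphic_map X Y f"
  shows "continuous_map (Sc X) (Sc Y) ((`) f)"
  unfolding Sc_def continuous_map_in_subtopology
proof
  show "continuous_map (subtopology (vietoris X) {S. nontrivial_convergent_sequence X S}) (vietoris Y) ((`) f)"
    using continuous_map_vietoris_image[OF assms] by (rule continuous_map_from_subtopology)
  show "(`) f \<in> topspace (subtopology (vietoris X) {S. nontrivial_convergent_sequence X S})
    \<rightarrow> {S. nontrivial_convergent_sequence Y S}"
    using nontrivial_convergent_sequence_image[OF assms] by simp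
qed

text \<open>Taking images is functorial, so inverse homeomorphisms of the base spaces induce inverse
  maps on sequences.\<close>

lemma homeomorphic_maps_Sc:
  assumes "homeomorphic_maps X Y f g"
  shows "homeomorphic_maps (Sc X) (Sc Y) ((`) f) ((`) g)"
proof -
  have gf: "\<And>x. x \<in> topspace X \<Longrightarrow> g (f x) = x" and fg: "\<And>y. y \<in> topspace Y \<Longrightarrow> f (g y) = y"
    using assms by (auto simp: homeomorphic_maps_def)
  have "continuous_map (Sc X) (Sc Y) ((`) f)" "continuous_map (Sc Y) (Sc X) ((`) g)"
    using assms by (simp_all add: continuous_map_Sc_image homeomorphic_maps_map)
  moreover have "g ` f ` S = S" if "S \<in> topspace (Sc X)" for S
  proof -
    have "S \<subseteq> topspace X"
      using that by (simp add: Sc_def nontrivial_convergent_sequence_def)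
    then show ?thesis using gf by force
  qed
  moreover have "f ` g ` S = S" if "S \<in> topspace (Sc Y)" for S
  proof -
    have "S \<subseteq> topspace Y"
      using that by (simp add: Sc_def nontrivial_convergent_sequence_def)
    then show ?thesis using fg by force
  qed
  ultimately show ?thesis
    by (simp add: homeomorphic_maps_def)
qed

section \<open>Gluing homeomorphisms\<close>

text \<open>Disjointness makes the piece containing a point unique, so the choice by
  \<open>SOME\<close> is forced; continuity is local on the open pieces.\<close>

lemma homeomorphism_UN:
  fixes U :: "'i \<Rightarrow> 'a::topological_space set" and V :: "'i \<Rightarrow> 'b::topological_space set"
  assumes U: "\<And>i. i \<in> I \<Longrightarrow> open (U i)" "disjoint_family_on U I"
    and V: "\<And>i. i \<in> I \<Longrightarrow> open (V i)" "disjoint_family_on V I"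
    and hom: "\<And>i. i \<in> I \<Longrightarrow> homeomorphism (U i) (V i) (h i) (k i)"
  obtains f g where "homeomorphism (\<Union>i\<in>I. U i) (\<Union>i\<in>I. V i) f g"
    "\<And>i p. i \<in> I \<Longrightarrow> p \<in> U i \<Longrightarrow> f p = h i p" "\<And>i p. i \<in> I \<Longrightarrow> p \<in> V i \<Longrightarrow> g p = k i p"
proof -
  define f where "f p = h (SOME i. i \<in> I \<and> p \<in> U i) p" for p
  define g where "g p = k (SOME i. i \<in> I \<and> p \<in> V i) p" for p
  have f: "f p = h i p" if "i \<in> I" "p \<in> U i" for i p
  proof -
    have "(SOME i. i \<in> I \<and> p \<in> U i) = i"
      using that U(2) by (intro some_equality) (auto simp: disjoint_family_on_def)
    then show ?thesis by (simp add: f_def)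
  qed
  have g: "g p = k i p" if "i \<in> I" "p \<in> V i" for i p
  proof -
    have "(SOME i. i \<in> I \<and> p \<in> V i) = i"
      using that V(2) by (intro some_equality) (auto simp: disjoint_family_on_def)
    then show ?thesis by (simp add: g_def)
  qed
  have piece: "homeomorphism (U i) (V i) f g" if "i \<in> I" for i
    using homeomorphism_cong[OF hom[OF that] refl refl] f g that by blast
  have "homeomorphism (\<Union>i\<in>I. U i) (\<Union>i\<in>I. V i) f g"
  proof
    show "continuous_on (\<Union>i\<in>I. U i) f" "continuous_on (\<Union>i\<in>I. V i) g"
      using U(1) V(1) piece by (auto intro!: continuous_on_open_UN simp: homeomorphism_def)
    show "f ` (\<Union>i\<in>I. U i) \<subseteq> (\<Union>i\<in>I. V i)" "g ` (\<Union>i\<in>I. V i) \<subseteq> (\<Union>i\<in>I. U i)"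
      using homeomorphism_image1[OF piece] homeomorphism_image2[OF piece] by (simp_all add: image_UN)
    show "g (f x) = x" if "x \<in> (\<Union>i\<in>I. U i)" for x
      using that homeomorphism_apply1[OF piece] by blast
    show "f (g y) = y" if "y \<in> (\<Union>i\<in>I. V i)" for y
      using that homeomorphism_apply2[OF piece] by blast
  qed
  then show thesis
    using f g by (rule that)
qed

text \<open>Continuity is in question only at \<open>x\<close>: all but finitely many pieces are
  mapped into a given neighborhood of \<open>f x\<close>.\<close>

lemma continuous_on_insert_limit_of_clopens:
  fixes U :: "'i \<Rightarrow> 'a::t1_space set" and f :: "'a \<Rightarrow> 'b::topological_space"
  assumes U: "\<And>i. closed (U i)" "(\<Union>i. U i) = - {x}"
    and f: "continuous_on (- {x}) f"
    and lim: "\<And>W. open W \<Longrightarrow> f x \<in> W \<Longrightarrow> finite {i. \<not> f ` U i \<subseteq> W}"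
  shows "continuous_on UNIV f"
proof -
  have "\<exists>A. open A \<and> p \<in> A \<and> (\<forall>y\<in>UNIV. y \<in> A \<longrightarrow> f y \<in> W)" if W: "open W" "f p \<in> W" for p W
  proof (cases "p = x")
    case True
    \<comment> \<open>Deleting the finitely many closed bad pieces leaves an open neighborhood of
      \<open>x\<close>.\<close>
    define A where "A = - (\<Union>i\<in>{i. \<not> f ` U i \<subseteq> W}. U i)"
    have "open A"
      unfolding A_def using lim W True U(1) by (auto intro!: closed_UN)
    moreover have "x \<in> A"
      using U(2) by (auto simp: A_def)
    moreover have "f y \<in> W" if "y \<in> A" for y
    proof (cases "y = x")
      case False
      then obtain i where "y \<in> U i" using U(2) by blast
      then show ?thesis using that by (auto simp: A_def)
    qed (use W True in simp)
    ultimately show ?thesis using True by blast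
  next
    case False
    then obtain A where "open A" "p \<in> A" "\<And>y. y \<in> - {x} \<Longrightarrow> y \<in> A \<Longrightarrow> f y \<in> W"
      using f W unfolding continuous_on_topological by (metis ComplI singletonD)
    then show ?thesis
      using False by (intro exI[of _ "A - {x}"]) auto
  qed
  then show ?thesis
    unfolding continuous_on_topological by blast
qed

text \<open>The pieces are glued away from \<open>x\<close> and \<open>y\<close>, and
  \<open>x\<close> is then sent to \<open>y\<close>. Continuity at the limit points, in both
  directions, comes from the pieces shrinking to them.\<close>

lemma homeomorphism_limit_of_clopens:
  fixes U :: "'i \<Rightarrow> 'a::t1_space set" and V :: "'i \<Rightarrow> 'b::t1_space set"
  assumes U: "\<And>i. open (U i)" "\<And>i. closed (U i)" "disjoint_family U" "(\<Union>i. U i) = - {x}"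
    and V: "\<And>i. open (V i)" "\<And>i. closed (V i)" "disjoint_family V" "(\<Union>i. V i) = - {y}"
    and limU: "\<And>W. open W \<Longrightarrow> x \<in> W \<Longrightarrow> finite {i. \<not> U i \<subseteq> W}"
    and limV: "\<And>W. open W \<Longrightarrow> y \<in> W \<Longrightarrow> finite {i. \<not> V i \<subseteq> W}"
    and hom: "\<And>i. homeomorphism (U i) (V i) (h i) (k i)"
  obtains f g where "homeomorphism UNIV UNIV f g" "f x = y" "\<And>i p. p \<in> U i \<Longrightarrow> f p = h i p"
proof -
  obtain f g where fg: "homeomorphism (- {x}) (- {y}) f g"
    and f: "\<And>i p. p \<in> U i \<Longrightarrow> f p = h i p" and g: "\<And>i p. p \<in> V i \<Longrightarrow> g p = k i p"
    using homeomorphism_UN[of UNIV U V h k] U V hom by auto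
  define f' where "f' = f(x := y)"
  define g' where "g' = g(y := x)"
  have x: "x \<notin> U i" and y: "y \<notin> V i" for i
    using U(4) V(4) by blast+
  have f': "f' p = h i p" if "p \<in> U i" for i p
    using that x[of i] f by (auto simp: f'_def)
  have g': "g' p = k i p" if "p \<in> V i" for i p
    using that y[of i] g by (auto simp: g'_def)
  have fU: "f' ` U i = V i" and gV: "g' ` V i = U i" for i
    using f' g' hom[of i] by (auto simp: homeomorphism_def cong: image_cong_simp)
  have "continuous_on (- {x}) f'"
    using fg by (auto simp: homeomorphism_def f'_def cong: continuous_on_cong_simp)
  then have cf: "continuous_on UNIV f'"
    by (rule continuous_on_insert_limit_of_clopens[OF U(2,4)])
      (use limV fU in \<open>simp add: f'_def\<close>)
  have "continuous_on (- {y}) g'"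
    using fg by (auto simp: homeomorphism_def g'_def cong: continuous_on_cong_simp)
  then have cg: "continuous_on UNIV g'"
    by (rule continuous_on_insert_limit_of_clopens[OF V(2,4)])
      (use limU gV in \<open>simp add: g'_def\<close>)
  have "f ` (- {x}) = - {y}" "g ` (- {y}) = - {x}"
    using fg by (auto simp: homeomorphism_def)
  \<comment> \<open>The unpatched maps avoid the limit points, so the patched values do not disturb
    the round trips.\<close>
  then have "f p \<noteq> y" if "p \<noteq> x" for p
    using that by blast
  moreover have "g p \<noteq> x" if "p \<noteq> y" for p
    using \<open>g ` (- {y}) = - {x}\<close> that by blast
  ultimately have "g' (f' p) = p" "f' (g' q) = q" for p q
    using homeomorphism_apply1[OF fg, of p] homeomorphism_apply2[OF fg, of q]
    by (simp_all add: f'_def g'_def)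
  then have "homeomorphism UNIV UNIV f' g'"
    using cf cg by (intro homeomorphismI) simp_all
  then show thesis
    using that f' by (auto simp: f'_def)
qed

text \<open>Both topologies are generated by rays, so only preimages of rays have to be
  examined.\<close>

lemma homeomorphism_strict_mono:
  fixes f :: "'a::linorder_topology \<Rightarrow> 'b::linorder_topology"
  assumes f: "strict_mono f" and range: "range f = {a..b}"
  shows "homeomorphism UNIV {a..b} f (inv f)"
proof
  have inj: "inj f"
    using f by (rule strict_mono_imp_inj_on)
  have less: "f x < f y \<longleftrightarrow> x < y" for x y
    using f by (rule strict_mono_less)
  have ab: "a \<le> f x" "f x \<le> b" for x
    using range by auto
  have f_inv: "f (inv f y) = y" if "y \<in> {a..b}" for y
    using that range by (intro f_inv_into_f) simp
  show "continuous_on UNIV f"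
  proof (rule continuous_on_generate_topology[OF open_generated_order])
    fix B :: "'b set"
    assume "B \<in> range lessThan \<union> range greaterThan"
    then obtain z where z: "B = {..<z} \<or> B = {z<..}" by blast
    \<comment> \<open>Since the range is a full interval, a ray either ends at a value of
      \<open>f\<close>, and pulls back to a ray, or ends outside the interval, and pulls back to
      everything or nothing.\<close>
    consider "z < a" | "b < z" | "z \<in> range f"
      unfolding range by force
    then have "open (f -` B)"
    proof cases
      case 1
      then have "z < f x" for x
        using ab(1) by (rule less_le_trans)
      then have "f -` {..<z} = {}" "f -` {z<..} = UNIV"
        by (auto dest: order.asym)
      then show ?thesis using z by auto
    next
      case 2
      then have "f x < z" for x
        using ab(2) by (rule le_less_trans[rotated])
      then have "f -` {..<z} = UNIV" "f -` {z<..} = {}"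
        by (auto dest: order.asym)
      then show ?thesis using z by auto
    next
      case 3
      then obtain x where "z = f x" by blast
      then have "f -` {..<z} = {..<x}" "f -` {z<..} = {x<..}"
        by (auto simp: less)
      then show ?thesis using z by auto
    qed
    then show "\<exists>C. open C \<and> C \<inter> UNIV = f -` B \<inter> UNIV" by auto
  qed
  show "continuous_on {a..b} (inv f)"
  proof (rule continuous_on_generate_topology[OF open_generated_order])
    fix B :: "'a set"
    assume "B \<in> range lessThan \<union> range greaterThan"
    then obtain z where z: "B = {..<z} \<or> B = {z<..}" by blast
    have "inv f y < z \<longleftrightarrow> y < f z" "z < inv f y \<longleftrightarrow> f z < y" if "y \<in> {a..b}" for y
      using less[of "inv f y" z] less[of z "inv f y"] f_inv[OF that] by simp_all
    then have "{..<f z} \<inter> {a..b} = inv f -` {..<z} \<inter> {a..b}"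
      "{f z<..} \<inter> {a..b} = inv f -` {z<..} \<inter> {a..b}"
      by auto
    with z show "\<exists>C. open C \<and> C \<inter> {a..b} = inv f -` B \<inter> {a..b}"
      by (metis open_lessThan open_greaterThan)
  qed
  show "f ` UNIV \<subseteq> {a..b}" "inv f ` {a..b} \<subseteq> UNIV"
    using range by simp_all
  show "inv f (f x) = x" for x
    using inj by simp
  show "f (inv f y) = y" if "y \<in> {a..b}" for y
    using that by (rule f_inv)
qed

section \<open>Homogeneity of the double arrow space\<close>

text \<open>\<open>lower t\<close> and \<open>upper t\<close> are \<open>t\<^sup>-\<close> and \<open>t\<^sup>+\<close>; the excluded points \<open>lower 0\<close> and \<open>upper 1\<close>
  are junk.\<close>

definition lower :: "real \<Rightarrow> double_arrow"
  where "lower t = Abs_double_arrow (t, 0)"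

definition upper :: "real \<Rightarrow> double_arrow"
  where "upper t = Abs_double_arrow (t, 1)"

lemma Rep_lower: "0 < t \<Longrightarrow> t \<le> 1 \<Longrightarrow> Rep_double_arrow (lower t) = (t, 0)"
  by (simp add: lower_def Abs_double_arrow_inverse)

lemma Rep_upper: "0 \<le> t \<Longrightarrow> t < 1 \<Longrightarrow> Rep_double_arrow (upper t) = (t, 1)"
  by (simp add: upper_def Abs_double_arrow_inverse)

lemma double_arrow_cases [case_names lower upper]:
  obtains t where "0 < t" "t \<le> 1" "p = lower t" | t where "0 \<le> t" "t < 1" "p = upper t"
  by (cases p) (auto simp: lower_def upper_def)

lemma less_double_arrow_simps [simp]:
  "0 < s \<Longrightarrow> s \<le> 1 \<Longrightarrow> 0 < t \<Longrightarrow> t \<le> 1 \<Longrightarrow> lower s < lower t \<longleftrightarrow> s < t"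
  "0 < s \<Longrightarrow> s \<le> 1 \<Longrightarrow> 0 \<le> t \<Longrightarrow> t < 1 \<Longrightarrow> lower s < upper t \<longleftrightarrow> s \<le> t"
  "0 \<le> s \<Longrightarrow> s < 1 \<Longrightarrow> 0 < t \<Longrightarrow> t \<le> 1 \<Longrightarrow> upper s < lower t \<longleftrightarrow> s < t"
  "0 \<le> s \<Longrightarrow> s < 1 \<Longrightarrow> 0 \<le> t \<Longrightarrow> t < 1 \<Longrightarrow> upper s < upper t \<longleftrightarrow> s < t"
  by (auto simp: less_double_arrow.rep_eq Rep_lower Rep_upper)

lemma le_double_arrow_simps [simp]:
  "0 < s \<Longrightarrow> s \<le> 1 \<Longrightarrow> 0 < t \<Longrightarrow> t \<le> 1 \<Longrightarrow> lower s \<le> lower t \<longleftrightarrow> s \<le> t"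
  "0 < s \<Longrightarrow> s \<le> 1 \<Longrightarrow> 0 \<le> t \<Longrightarrow> t < 1 \<Longrightarrow> lower s \<le> upper t \<longleftrightarrow> s \<le> t"
  "0 \<le> s \<Longrightarrow> s < 1 \<Longrightarrow> 0 < t \<Longrightarrow> t \<le> 1 \<Longrightarrow> upper s \<le> lower t \<longleftrightarrow> s < t"
  "0 \<le> s \<Longrightarrow> s < 1 \<Longrightarrow> 0 \<le> t \<Longrightarrow> t < 1 \<Longrightarrow> upper s \<le> upper t \<longleftrightarrow> s \<le> t"
  by (simp_all only: not_less [symmetric] less_double_arrow_simps) auto

lemma upper_0_le [simp]: "upper 0 \<le> p"
  by (cases p rule: double_arrow_cases) auto

lemma le_lower_1 [simp]: "p \<le> lower 1"
  by (cases p rule: double_arrow_cases) auto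

section \<open>Jumps of the order and clopen intervals\<close>

lemma le_lower_or_upper_le:
  assumes "0 < b" "b < 1"
  shows "p \<le> lower b \<or> upper b \<le> p"
  using assms by (cases p rule: double_arrow_cases) auto

text \<open>Any two points are separated by a jump from \<open>lower b\<close> to
  \<open>upper b\<close>: between different reals take the midpoint, and for adjacent points the
  common real. This later cuts between consecutive terms of a sequence.\<close>

lemma exists_cut:
  fixes p q :: double_arrow
  assumes "p < q"
  obtains b where "0 < b" "b < 1" "p \<le> lower b" "upper b \<le> q"
proof (cases p rule: double_arrow_cases)
  case (lower s)
  show thesis
  proof (cases q rule: double_arrow_cases)
    case l: (lower t)
    with lower assms have "s < t" by simp
    with lower l show thesis using that[of "(s + t) / 2"] by simp
  next
    case (upper t)
    with lower assms show thesis using that[of s] by simp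
  qed
next
  case (upper s)
  show thesis
  proof (cases q rule: double_arrow_cases)
    case (lower t)
    with upper assms have "s < t" by simp
    with lower upper show thesis using that[of "(s + t) / 2"] by simp
  next
    case u: (upper t)
    with upper assms have "s < t" by simp
    with u upper show thesis using that[of "(s + t) / 2"] by simp
  qed
qed

text \<open>\<open>upper c\<close> is the immediate successor of \<open>lower c\<close>, or the
  least point if \<open>c = 0\<close>; dually for \<open>lower d\<close>. So both closed rays are
  open.\<close>

lemma open_upper_lower:
  assumes "0 \<le> c" "c < d" "d \<le> 1"
  shows "open {upper c..lower d}"
proof -
  have "open {upper c..}"
  proof (cases "c = 0")
    case False
    then have "{upper c..} = {lower c<..}"
      using assms le_lower_or_upper_le[of c] by (force intro: less_le_trans[of _ "upper c"])
    then show ?thesis by simp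
  qed (simp add: atLeast_def)
  moreover have "open {..lower d}"
  proof (cases "d = 1")
    case False
    then have "{..lower d} = {..<upper d}"
      using assms le_lower_or_upper_le[of d] by (force intro: le_less_trans[of _ "lower d"])
    then show ?thesis by simp
  qed (simp add: atMost_def)
  ultimately show ?thesis
    by (simp add: atLeastAtMost_def open_Int)
qed

section \<open>Affine copies of the whole space\<close>

definition stretch :: "real \<Rightarrow> real \<Rightarrow> double_arrow \<Rightarrow> double_arrow"
  where "stretch c d p =
    Abs_double_arrow (c + (d - c) * fst (Rep_double_arrow p), snd (Rep_double_arrow p))"

lemma stretch_lower: "0 < t \<Longrightarrow> t \<le> 1 \<Longrightarrow> stretch c d (lower t) = lower (c + (d - c) * t)"
  by (simp add: stretch_def Rep_lower lower_def[of "c + _"])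

lemma stretch_upper: "0 \<le> t \<Longrightarrow> t < 1 \<Longrightarrow> stretch c d (upper t) = upper (c + (d - c) * t)"
  by (simp add: stretch_def Rep_upper upper_def[of "c + _"])

text \<open>The affine map \<open>m\<close> carries [0,1] increasingly onto [c,d] and the second
  coordinate is kept, so \<open>stretch c d\<close> is an order isomorphism onto the
  interval.\<close>

lemma homeomorphism_stretch:
  assumes cd: "0 \<le> c" "c < d" "d \<le> 1"
  shows "homeomorphism UNIV {upper c..lower d} (stretch c d) (inv (stretch c d))"
proof (rule homeomorphism_strict_mono)
  define m where "m t = c + (d - c) * t" for t
  have m_less: "m s < m t \<longleftrightarrow> s < t" and m_le: "m s \<le> m t \<longleftrightarrow> s \<le> t" for s t
    using cd by (simp_all add: m_def)
  have m01: "m 0 = c" "m 1 = d"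
    by (simp_all add: m_def)
  have m_pos: "0 < m t" if "0 < t" for t
    using m_less[of 0 t] that cd m01 by simp
  have m_nonneg: "0 \<le> m t" if "0 \<le> t" for t
    using m_le[of 0 t] that cd m01 by simp
  have m_le_1: "m t \<le> 1" if "t \<le> 1" for t
    using m_le[of t 1] that cd m01 by simp
  have m_less_1: "m t < 1" if "t < 1" for t
    using m_less[of t 1] that cd m01 by simp
  note m = m_less m_le m_pos m_nonneg m_le_1 m_less_1
  have st: "0 < t \<Longrightarrow> t \<le> 1 \<Longrightarrow> stretch c d (lower t) = lower (m t)"
    "0 \<le> t \<Longrightarrow> t < 1 \<Longrightarrow> stretch c d (upper t) = upper (m t)" for t
    by (simp_all add: stretch_lower stretch_upper m_def)
  show "strict_mono (stretch c d)"
  proof (rule strict_monoI)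
    fix p q :: double_arrow
    assume "p < q"
    then show "stretch c d p < stretch c d q"
      by (cases p rule: double_arrow_cases; cases q rule: double_arrow_cases) (simp_all add: st m)
  qed
  show "range (stretch c d) = {upper c..lower d}"
  proof
    have "upper c \<le> stretch c d p" "stretch c d p \<le> lower d" for p
      using m_le[of _ 1] m_less[of _ 1] m_le[of 0] m_less[of 0] cd m01
      by (cases p rule: double_arrow_cases; simp add: st m)+
    then show "range (stretch c d) \<subseteq> {upper c..lower d}"
      by auto
    show "{upper c..lower d} \<subseteq> range (stretch c d)"
    proof
      fix q assume q: "q \<in> {upper c..lower d}"
      have inv: "m ((t - c) / (d - c)) = t" for t
        using cd by (simp add: m_def)
      show "q \<in> range (stretch c d)"
      proof (cases q rule: double_arrow_cases)
        case (lower t)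
        then have "stretch c d (lower ((t - c) / (d - c))) = q"
          using q cd by (simp add: st inv)
        then show ?thesis by blast
      next
        case (upper t)
        then have "stretch c d (upper ((t - c) / (d - c))) = q"
          using q cd by (simp add: st inv)
        then show ?thesis by blast
      qed
    qed
  qed
qed

text \<open>The subtraction in the second coordinate is truncated, but there it only exchanges 0 and
  1.\<close>

definition reflect :: "double_arrow \<Rightarrow> double_arrow"
  where "reflect p =
    Abs_double_arrow (1 - fst (Rep_double_arrow p), 1 - snd (Rep_double_arrow p))"

lemma reflect_lower: "0 < t \<Longrightarrow> t \<le> 1 \<Longrightarrow> reflect (lower t) = upper (1 - t)"
  by (simp add: reflect_def Rep_lower upper_def)

lemma reflect_upper: "0 \<le> t \<Longrightarrow> t < 1 \<Longrightarrow> reflect (upper t) = lower (1 - t)"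
  by (simp add: reflect_def Rep_upper lower_def)

lemma reflect_reflect [simp]: "reflect (reflect p) = p"
  by (cases p rule: double_arrow_cases) (simp_all add: reflect_lower reflect_upper)

text \<open>Order reversal, stated in the form that computes preimages of rays under this
  involution.\<close>

lemma reflect_less_iff: "reflect p < q \<longleftrightarrow> reflect q < p"
  by (cases p rule: double_arrow_cases; cases q rule: double_arrow_cases)
    (auto simp: reflect_lower reflect_upper)

lemma homeomorphism_reflect: "homeomorphism UNIV UNIV reflect reflect"
proof -
  have "reflect -` {..<z} = {reflect z<..}" "reflect -` {z<..} = {..<reflect z}" for z
    using reflect_less_iff[of _ z] reflect_less_iff[of "reflect _" "reflect z"] by auto
  then have "continuous_on UNIV reflect"
    by (intro continuous_on_generate_topology[OF open_generated_order]) auto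
  then show ?thesis
    by (intro homeomorphismI) auto
qed

section \<open>Homeomorphisms between clopen intervals and homogeneity\<close>

lemma homeomorphism_upper_lower:
  assumes "0 \<le> c" "c < d" "d \<le> 1" "0 \<le> c'" "c' < d'" "d' \<le> 1"
  obtains f g where "homeomorphism {upper c..lower d} {upper c'..lower d'} f g" "f (upper c) = upper c'"
proof
  show "homeomorphism {upper c..lower d} {upper c'..lower d'}
      (stretch c' d' \<circ> inv (stretch c d)) (stretch c d \<circ> inv (stretch c' d'))"
    using homeomorphism_compose[OF homeomorphism_symD] homeomorphism_stretch assms by blast
  have "inv (stretch c d) (stretch c d (upper 0)) = upper 0"
    using homeomorphism_apply1[OF homeomorphism_stretch] assms by blast
  then show "(stretch c' d' \<circ> inv (stretch c d)) (upper c) = upper c'"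
    by (simp add: stretch_upper)
qed

text \<open>A single base point suffices for homogeneity: two points are connected by one such map
  followed by the inverse of another.\<close>

lemma homeomorphism_to_upper_0:
  fixes p :: double_arrow
  obtains f g where "homeomorphism UNIV UNIV f g" "f p = upper 0"
proof -
  \<comment> \<open>The points \<open>upper a\<close> come first; the points \<open>lower t\<close>
    are reduced to them by reflection.\<close>
  have *: "\<exists>f g. homeomorphism UNIV UNIV f g \<and> f (upper a) = upper 0" if a: "0 \<le> a" "a < 1" for a
  proof (cases "a = 0")
    case True
    then show ?thesis
      by (intro exI[of _ "\<lambda>x. x"]) (auto intro: homeomorphismI)
  next
    case False
    obtain f1 g1 where 1: "homeomorphism {upper 0..lower a} {upper (1 - a)..lower 1} f1 g1"
      by (rule homeomorphism_upper_lower[of 0 a "1 - a" 1]) (use a False in auto)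
    obtain f2 g2 where 2: "homeomorphism {upper a..lower 1} {upper 0..lower (1 - a)} f2 g2"
      "f2 (upper a) = upper 0"
      by (rule homeomorphism_upper_lower[of a 1 0 "1 - a"]) (use a False in auto)
    \<comment> \<open>The blocks are indexed by truth values: \<open>True\<close> is the left block,
      moved to the right end, and \<open>False\<close> the right block, moved to the left
      end.\<close>
    define U where "U i = (if i then {upper 0..lower a} else {upper a..lower 1})" for i
    define V where "V i = (if i then {upper (1 - a)..lower 1} else {upper 0..lower (1 - a)})" for i
    define h where "h i = (if i then f1 else f2)" for i
    define k where "k i = (if i then g1 else g2)" for i
    have UN: "(\<Union>i. U i) = UNIV" "(\<Union>i. V i) = UNIV"
      using le_lower_or_upper_le[of a] le_lower_or_upper_le[of "1 - a"] a False
      by (auto simp: U_def V_def UNIV_bool) blast+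
    have less: "lower a < upper a" "lower (1 - a) < upper (1 - a)"
      using a False by simp_all
    have opn: "open (U i)" "open (V i)" for i
      using a False by (simp_all add: U_def V_def open_upper_lower)
    have disj: "disjoint_family U" "disjoint_family V"
      using less by (auto simp: disjoint_family_on_def U_def V_def)
    have hom: "homeomorphism (U i) (V i) (h i) (k i)" for i
      using 1 2 by (simp add: U_def V_def h_def k_def)
    obtain f g where "homeomorphism (\<Union>i. U i) (\<Union>i. V i) f g"
      and f: "\<And>i p. p \<in> U i \<Longrightarrow> f p = h i p"
      by (rule homeomorphism_UN[of UNIV, OF opn(1) disj(1) opn(2) disj(2) hom]) auto
    moreover have "f (upper a) = upper 0"
      using f[of "upper a" False] 2 a by (simp add: U_def h_def)
    ultimately show ?thesis
      unfolding UN by blast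
  qed
  show thesis
  proof (cases p rule: double_arrow_cases)
    case (lower t)
    obtain f g where fg: "homeomorphism UNIV UNIV f g" "f (upper (1 - t)) = upper 0"
      using *[of "1 - t"] lower by auto
    have "homeomorphism UNIV UNIV (f \<circ> reflect) (reflect \<circ> g)"
      using homeomorphism_compose[OF homeomorphism_reflect fg(1)] .
    then show thesis
      using that fg(2) lower by (simp add: reflect_lower)
  next
    case (upper t)
    then show thesis
      using *[of t] that by blast
  qed
qed

text \<open>Both points are pulled back to the whole space and matched there through
  \<open>upper 0\<close>.\<close>

lemma homeomorphism_upper_lower_point:
  assumes "0 \<le> c" "c < d" "d \<le> 1" "0 \<le> c'" "c' < d'" "d' \<le> 1"
    and p: "p \<in> {upper c..lower d}" and q: "q \<in> {upper c'..lower d'}"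
  obtains f g where "homeomorphism {upper c..lower d} {upper c'..lower d'} f g" "f p = q"
proof -
  let ?s = "stretch c d" and ?s' = "stretch c' d'"
  have s: "homeomorphism UNIV {upper c..lower d} ?s (inv ?s)"
    and s': "homeomorphism UNIV {upper c'..lower d'} ?s' (inv ?s')"
    using assms by (simp_all add: homeomorphism_stretch)
  obtain f g where fg: "homeomorphism UNIV UNIV f g" "f (inv ?s p) = upper 0"
    by (rule homeomorphism_to_upper_0)
  obtain f' g' where fg': "homeomorphism UNIV UNIV f' g'" "f' (inv ?s' q) = upper 0"
    by (rule homeomorphism_to_upper_0)
  have "homeomorphism {upper c..lower d} {upper c'..lower d'}
      (?s' \<circ> (g' \<circ> (f \<circ> inv ?s))) (((?s \<circ> g) \<circ> f') \<circ> inv ?s')"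
    using homeomorphism_compose[OF homeomorphism_compose[OF homeomorphism_compose[OF
      homeomorphism_symD[OF s] fg(1)] homeomorphism_symD[OF fg'(1)]] s'] .
  moreover have "g' (upper 0) = inv ?s' q"
    using homeomorphism_apply1[OF fg'(1), of "inv ?s' q"] fg'(2) by simp
  then have "(?s' \<circ> (g' \<circ> (f \<circ> inv ?s))) p = q"
    using fg(2) homeomorphism_apply2[OF s' q] by simp
  ultimately show thesis by (rule that)
qed

section \<open>Matching convergent sequences\<close>

text \<open>Finiteness of the upper parts gives every nonempty subset of \<open>A\<close> a greatest
  element, so the elements can be listed from the top, always taking the next largest.\<close>

lemma decreasing_enumeration:
  fixes A :: "'a::linorder set"
  assumes inf: "infinite A" and fin: "\<And>t. t \<in> A \<Longrightarrow> finite (A \<inter> {t..})"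
  obtains m :: "nat \<Rightarrow> 'a" where "range m = A" "\<And>n. m (Suc n) < m n"
proof -
  have greatest: "\<exists>x\<in>B. \<forall>y\<in>B. y \<le> x" if B: "B \<subseteq> A" "B \<noteq> {}" for B
  proof -
    obtain b where b: "b \<in> B" using B by blast
    have f: "finite (B \<inter> {b..})"
      using B b by (intro finite_subset[OF _ fin[of b]]) auto
    have "Max (B \<inter> {b..}) \<in> B \<inter> {b..}"
      using f b by (intro Max_in) auto
    moreover have "y \<le> Max (B \<inter> {b..})" if "y \<in> B" for y
    proof (cases "b \<le> y")
      case False
      then show ?thesis
        using \<open>Max (B \<inter> {b..}) \<in> B \<inter> {b..}\<close> by auto
    qed (use f that in simp)
    ultimately show ?thesis by blast
  qed
  have ne: "A \<inter> {..<x} \<noteq> {}" if "x \<in> A" for x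
  proof
    assume "A \<inter> {..<x} = {}"
    then have "A \<subseteq> A \<inter> {x..}" by (force simp: not_less)
    then show False
      using fin[OF that] inf finite_subset by blast
  qed
  \<comment> \<open>The clause for \<open>n = 0\<close> starts the recursion at the maximum of
    \<open>A\<close>; the last clause ensures that no element is skipped.\<close>
  have "\<exists>m. \<forall>n. (m n \<in> A \<and> (n = 0 \<longrightarrow> (\<forall>y\<in>A. y \<le> m n))) \<and>
      (m (Suc n) < m n \<and> (\<forall>z\<in>A. z < m n \<longrightarrow> z \<le> m (Suc n)))"
  proof (rule dependent_nat_choice)
    have "A \<noteq> {}" using inf by auto
    then show "\<exists>x. x \<in> A \<and> ((0::nat) = 0 \<longrightarrow> (\<forall>y\<in>A. y \<le> x))"
      using greatest[of A] by blast
  next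
    fix x and n :: nat
    assume "x \<in> A \<and> (n = 0 \<longrightarrow> (\<forall>y\<in>A. y \<le> x))"
    then show "\<exists>y. (y \<in> A \<and> (Suc n = 0 \<longrightarrow> (\<forall>z\<in>A. z \<le> y))) \<and> y < x \<and> (\<forall>z\<in>A. z < x \<longrightarrow> z \<le> y)"
      using greatest[of "A \<inter> {..<x}"] ne[of x] by auto
  qed
  then obtain m where m: "\<And>n. m n \<in> A" "\<And>y. y \<in> A \<Longrightarrow> y \<le> m 0"
    "\<And>n. m (Suc n) < m n" "\<And>n z. z \<in> A \<Longrightarrow> z < m n \<Longrightarrow> z \<le> m (Suc n)"
    by blast
  \<comment> \<open>A missed \<open>y\<close> would lie below every term, leaving infinitely many
    elements of \<open>A\<close> above it.\<close>
  have "y \<in> range m" if y: "y \<in> A" for y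
  proof (rule ccontr)
    assume "y \<notin> range m"
    then have noteq: "y \<noteq> m n" for n by blast
    have "y < m n" for n
    proof (induction n)
      case 0
      then show ?case using m(2)[OF y] noteq[of 0] by simp
    next
      case (Suc n)
      then show ?case using m(4)[OF y] noteq[of "Suc n"] by (simp add: order.not_eq_order_implies_strict)
    qed
    then have "range m \<subseteq> A \<inter> {y..}"
      using m(1) by (auto intro: less_imp_le)
    then have "finite (range m)"
      using fin[OF y] finite_subset by blast
    moreover have "inj m"
    proof (rule linorder_injI)
      fix i j :: nat assume "i < j"
      then have "m j < m i"
        by (induction rule: less_Suc_induct) (auto intro: m(3) order.strict_trans)
      then show "m i \<noteq> m j" by simp
    qed
    ultimately show False
      using finite_imageD by blast
  qed
  then have "range m = A" using m(1) by blast
  then show thesis using m(3) by (rule that)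
qed

text \<open>The terms other than \<open>upper 0\<close> are listed decreasingly and the space is cut
  at a jump between each two neighbors; convergence makes the resulting intervals shrink to
  \<open>upper 0\<close>.\<close>

lemma interval_partition_of_sequence:
  assumes inf: "infinite S" and S: "\<And>V. open V \<Longrightarrow> upper 0 \<in> V \<Longrightarrow> finite (S - V)"
  obtains m :: "nat \<Rightarrow> double_arrow" and c :: "nat \<Rightarrow> real"
  where "range m = S - {upper 0}"
    "\<And>n. 0 < c (Suc n)" "\<And>n. c (Suc n) < c n" "\<And>n. c n \<le> 1"
    "\<And>n. m n \<in> {upper (c (Suc n))..lower (c n)}"
    "disjoint_family (\<lambda>n. {upper (c (Suc n))..lower (c n)})"
    "(\<Union>n. {upper (c (Suc n))..lower (c n)}) = - {upper 0}"
    "\<And>W. open W \<Longrightarrow> upper 0 \<in> W \<Longrightarrow> finite {n. \<not> {upper (c (Suc n))..lower (c n)} \<subseteq> W}"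
proof -
  have fin: "finite (S \<inter> {t..})" if "t \<noteq> upper 0" for t
  proof -
    have "upper 0 < t"
      using that by (simp add: order.not_eq_order_implies_strict)
    then have "finite (S - {..<t})" by (intro S) auto
    moreover have "S - {..<t} = S \<inter> {t..}" by auto
    ultimately show ?thesis by simp
  qed
  obtain m where m: "range m = S - {upper 0}" and dec: "\<And>n. m (Suc n) < m n"
  proof (rule decreasing_enumeration)
    show "infinite (S - {upper 0})" using inf by simp
    show "finite ((S - {upper 0}) \<inter> {t..})" if "t \<in> S - {upper 0}" for t
      using fin[of t] that by (auto intro: finite_subset)
  qed blast
  have "\<exists>b. 0 < b \<and> b < 1 \<and> m (Suc n) \<le> lower b \<and> upper b \<le> m n" for n
    using exists_cut[OF dec[of n]] by metis
  then obtain b where b: "\<And>n. 0 < b n" "\<And>n. b n < 1" "\<And>n. m (Suc n) \<le> lower (b n)" "\<And>n. upper (b n) \<le> m n"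
    by metis
  \<comment> \<open>The shift by one puts the top \<open>lower 1\<close> of the space at the end of
    interval 0; the cut \<open>b n\<close> separates intervals \<open>n\<close> and
    \<open>Suc n\<close>.\<close>
  define c where "c n = (case n of 0 \<Rightarrow> 1 | Suc k \<Rightarrow> b k)" for n
  define J where "J n = {upper (c (Suc n))..lower (c n)}" for n
  have c_Suc: "c (Suc n) = b n" for n by (simp add: c_def)
  have mJ: "m n \<in> J n" for n
    using b by (cases n) (auto simp: J_def c_def)
  have pos: "0 < c n" and le1: "c n \<le> 1" and less1: "c (Suc n) < 1" for n
    using b(1,2) by (auto simp: c_def less_imp_le split: nat.split)
  have c_dec: "c (Suc n) < c n" for n
  proof -
    \<comment> \<open>The interval contains \<open>m n\<close>; an upper point below a lower one
      forces strict inequality of the reals.\<close>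
    have "upper (c (Suc n)) \<le> lower (c n)"
      using mJ[of n] unfolding J_def by (auto intro: order.trans)
    then show ?thesis
      using pos[of n] pos[of "Suc n"] le1[of n] less1[of n] by simp
  qed
  have c_anti: "c j \<le> c i" if "i \<le> j" for i j
    using lift_Suc_antimono_le[of c] c_dec that by (simp add: less_imp_le)
  have J_below: "p < upper (c (Suc i))" if "i < j" "p \<in> J j" for i j p
  proof -
    have "p \<le> lower (c j)" using that by (simp add: J_def)
    also have "lower (c j) < upper (c (Suc i))"
      using that(1) c_anti[of "Suc i" j] pos[of j] le1[of j] pos[of "Suc i"] less1[of i] by simp
    finally show ?thesis .
  qed
  have upper_J: "upper (c (Suc n)) \<in> J n" for n
    using c_dec[of n] pos[of n] pos[of "Suc n"] le1[of n] less1[of n] by (simp add: J_def)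
  have disj: "disjoint_family J"
  proof -
    have "J i \<inter> J j = {}" if "i < j" for i j
      using J_below[OF that] by (force simp: J_def)
    then show ?thesis
      unfolding disjoint_family_on_def by (metis Int_commute linorder_neqE)
  qed
  have lim: "finite {n. \<not> J n \<subseteq> W}" if W: "open W" "upper 0 \<in> W" for W
  proof -
    obtain t where t: "upper 0 < t" "{upper 0..<t} \<subseteq> W"
      using open_right[OF W, of "lower 1"] by auto
    \<comment> \<open>Otherwise infinitely many points of \<open>S\<close> would stay above
      \<open>t\<close>, against convergence to \<open>upper 0\<close>.\<close>
    have "\<exists>N. m N < t"
    proof (rule ccontr)
      assume "\<nexists>N. m N < t"
      then have "range m \<subseteq> {t..}"
        by (auto simp: not_less)
      then have "S - {upper 0} \<subseteq> S \<inter> {t..}"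
        using m by blast
      moreover have "finite (S \<inter> {t..})"
        using t(1) by (intro fin) auto
      ultimately have "finite (S - {upper 0})"
        by (rule finite_subset)
      then show False
        using inf by simp
    qed
    then obtain N where N: "m N < t" by blast
    have "J n \<subseteq> W" if "N < n" for n
    proof
      fix p assume "p \<in> J n"
      then have "p < upper (c (Suc N))" using J_below that by blast
      also have "\<dots> \<le> m N" using b(4) by (simp add: c_Suc)
      also note N
      finally show "p \<in> W" using t(2) by auto
    qed
    then have "{n. \<not> J n \<subseteq> W} \<subseteq> {..N}"
      by (force simp: not_less[symmetric])
    then show ?thesis using finite_subset by blast
  qed
  have "p \<in> (\<Union>n. J n)" if p: "p \<noteq> upper 0" for p
  proof -
    \<comment> \<open>The intervals eventually lie below \<open>p\<close>, so some left end does;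
      the first such index gives the interval containing \<open>p\<close>.\<close>
    have "finite {n. \<not> J n \<subseteq> {..<p}}"
      using p by (intro lim) (simp_all add: order.not_eq_order_implies_strict)
    then obtain n where "J n \<subseteq> {..<p}"
      using infinite_UNIV_nat by (metis (mono_tags, lifting) UNIV_eq_I mem_Collect_eq)
    then have ex: "upper (c (Suc n)) \<le> p"
      using upper_J[of n] by auto
    define k where "k = (LEAST n. upper (c (Suc n)) \<le> p)"
    have k: "upper (c (Suc k)) \<le> p"
      unfolding k_def using ex by (rule LeastI)
    have "p \<le> lower (c k)"
    \<comment> \<open>For a successor, minimality puts \<open>p\<close> left of the preceding cut;
      for \<open>k = 0\<close> the right end is the top of the space.\<close>
    proof (cases k)
      case (Suc i)
      then have "\<not> upper (c (Suc i)) \<le> p"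
        unfolding k_def by (intro not_less_Least) simp
      then show ?thesis
        using le_lower_or_upper_le[of "c k" p] pos[of k] less1[of i] Suc by auto
    qed (simp add: c_def)
    with k show ?thesis by (auto simp: J_def)
  qed
  moreover have "upper 0 \<notin> J n" for n
    using pos[of "Suc n"] less1[of n] by (simp add: J_def)
  ultimately have "(\<Union>n. J n) = - {upper 0}" by blast
  then show thesis
    using that[of m c] m pos c_dec le1 mJ disj lim unfolding J_def by blast
qed

text \<open>The \<open>n\<close>-th intervals are matched with \<open>m n\<close> going to
  \<open>m' n\<close>; the glued map fixes \<open>upper 0\<close>, so it carries the whole of
  \<open>S\<close> to \<open>T\<close>.\<close>

lemma sequences_to_upper_0_equivalent:
  assumes S: "infinite S" "upper 0 \<in> S" "\<And>V. open V \<Longrightarrow> upper 0 \<in> V \<Longrightarrow> finite (S - V)"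
    and T: "infinite T" "upper 0 \<in> T" "\<And>V. open V \<Longrightarrow> upper 0 \<in> V \<Longrightarrow> finite (T - V)"
  obtains f g where "homeomorphism UNIV UNIV f g" "f ` S = T"
proof -
  obtain m c where m: "range m = S - {upper 0}"
    and c: "\<And>n. 0 < c (Suc n)" "\<And>n. c (Suc n) < c n" "\<And>n. c n \<le> 1"
    and mc: "\<And>n. m n \<in> {upper (c (Suc n))..lower (c n)}"
    and J: "disjoint_family (\<lambda>n. {upper (c (Suc n))..lower (c n)})"
      "(\<Union>n. {upper (c (Suc n))..lower (c n)}) = - {upper 0}"
      "\<And>W. open W \<Longrightarrow> upper 0 \<in> W \<Longrightarrow> finite {n. \<not> {upper (c (Suc n))..lower (c n)} \<subseteq> W}"
    using interval_partition_of_sequence[OF S(1,3)] by blast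
  obtain m' c' where m': "range m' = T - {upper 0}"
    and c': "\<And>n. 0 < c' (Suc n)" "\<And>n. c' (Suc n) < c' n" "\<And>n. c' n \<le> 1"
    and mc': "\<And>n. m' n \<in> {upper (c' (Suc n))..lower (c' n)}"
    and J': "disjoint_family (\<lambda>n. {upper (c' (Suc n))..lower (c' n)})"
      "(\<Union>n. {upper (c' (Suc n))..lower (c' n)}) = - {upper 0}"
      "\<And>W. open W \<Longrightarrow> upper 0 \<in> W \<Longrightarrow> finite {n. \<not> {upper (c' (Suc n))..lower (c' n)} \<subseteq> W}"
    using interval_partition_of_sequence[OF T(1,3)] by blast
  have "\<exists>h k. homeomorphism {upper (c (Suc n))..lower (c n)} {upper (c' (Suc n))..lower (c' n)} h k \<and>
      h (m n) = m' n" for n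
    by (rule homeomorphism_upper_lower_point[of "c (Suc n)" "c n" "c' (Suc n)" "c' n" "m n" "m' n"])
      (use c c' mc mc' in \<open>auto simp: less_imp_le\<close>)
  then obtain h k where
    hk: "\<And>n. homeomorphism {upper (c (Suc n))..lower (c n)} {upper (c' (Suc n))..lower (c' n)} (h n) (k n)"
    and hm: "\<And>n. h n (m n) = m' n"
    by metis
  have "open {upper (c (Suc n))..lower (c n)}" "open {upper (c' (Suc n))..lower (c' n)}" for n
    using c c' by (simp_all add: open_upper_lower less_imp_le)
  then obtain f g where fg: "homeomorphism UNIV UNIV f g" and f0: "f (upper 0) = upper 0"
    and f: "\<And>n p. p \<in> {upper (c (Suc n))..lower (c n)} \<Longrightarrow> f p = h n p"
    using homeomorphism_limit_of_clopens[OF _ closed_atLeastAtMost J(1,2) _ closed_atLeastAtMost J'(1,2)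
      J(3) J'(3) hk] by blast
  have "f (m n) = m' n" for n
    using f[OF mc] hm by simp
  then have "f ` range m = range m'"
    by (simp add: image_image)
  moreover have "S = insert (upper 0) (range m)" "T = insert (upper 0) (range m')"
    using m m' S(2) T(2) by auto
  ultimately have "f ` S = T"
    using f0 by simp
  with fg show thesis by (rule that)
qed

section \<open>Reduction to the common limit \<open>upper 0\<close>\<close>

lemma nontrivial_convergent_sequence_to_upper_0:
  assumes "nontrivial_convergent_sequence euclidean (S :: double_arrow set)"
  obtains f g where "homeomorphism UNIV UNIV f g" "infinite (f ` S)" "upper 0 \<in> f ` S"
    "\<And>V. open V \<Longrightarrow> upper 0 \<in> V \<Longrightarrow> finite (f ` S - V)"
proof -
  obtain x where inf: "infinite S" and x: "x \<in> S" and fin: "\<And>V. open V \<Longrightarrow> x \<in> V \<Longrightarrow> finite (S - V)"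
    using assms by (auto simp: nontrivial_convergent_sequence_def)
  obtain f g where fg: "homeomorphism UNIV UNIV f g" and fx: "f x = upper 0"
    by (rule homeomorphism_to_upper_0)
  have "inj f"
    using homeomorphism_apply1[OF fg] by (intro inj_on_inverseI[of _ g]) simp
  then have "infinite (f ` S)"
    using inf finite_imageD inj_on_subset by blast
  moreover have "upper 0 \<in> f ` S"
    using x fx by force
  moreover have "finite (f ` S - V)" if "open V" "upper 0 \<in> V" for V
    using finite_image_Diff_open[of euclidean euclidean f S x V] that x fx fin fg
    by (simp add: homeomorphism_def)
  ultimately show thesis
    using that fg by blast
qed

lemma nontrivial_convergent_sequences_equivalent:
  assumes "nontrivial_convergent_sequence euclidean (S :: double_arrow set)"
    and "nontrivial_convergent_sequence euclidean (T :: double_arrow set)"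
  obtains f g where "homeomorphism UNIV UNIV f g" "f ` S = T"
proof -
  obtain f g where fg: "homeomorphism UNIV UNIV f g" and S: "infinite (f ` S)" "upper 0 \<in> f ` S"
    "\<And>V. open V \<Longrightarrow> upper 0 \<in> V \<Longrightarrow> finite (f ` S - V)"
    using nontrivial_convergent_sequence_to_upper_0[OF assms(1)] by metis
  obtain f' g' where fg': "homeomorphism UNIV UNIV f' g'" and T: "infinite (f' ` T)" "upper 0 \<in> f' ` T"
    "\<And>V. open V \<Longrightarrow> upper 0 \<in> V \<Longrightarrow> finite (f' ` T - V)"
    using nontrivial_convergent_sequence_to_upper_0[OF assms(2)] by metis
  obtain h k where hk: "homeomorphism UNIV UNIV h k" and h: "h ` f ` S = f' ` T"
    using sequences_to_upper_0_equivalent[OF S T] by metis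
  \<comment> \<open>\<open>S\<close> goes to its normalized copy, then to that of \<open>T\<close>,
    and \<open>g'\<close> undoes the normalization of \<open>T\<close>.\<close>
  have "g' ` f' ` T = T"
    using homeomorphism_apply1[OF fg'] by (simp add: image_image)
  then have "(g' \<circ> (h \<circ> f)) ` S = T"
    using h by (simp only: image_comp[symmetric])
  then show thesis
    using that[OF homeomorphism_compose[OF homeomorphism_compose[OF fg hk] homeomorphism_symD[OF fg']]]
    by blast
qed

theorem theorem1p4:
  shows "homogeneous_space (Sc (euclidean :: double_arrow topology))"
  unfolding homogeneous_space_def
proof (intro ballI)
  fix S T :: "double_arrow set"
  assume "S \<in> topspace (Sc euclidean)" "T \<in> topspace (Sc euclidean)"
  then have "nontrivial_convergent_sequence euclidean S" "nontrivial_convergent_sequence euclidean T"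
    by (simp_all add: Sc_def)
  then obtain f g where fg: "homeomorphism UNIV UNIV f g" and "f ` S = T"
    by (rule nontrivial_convergent_sequences_equivalent)
  moreover have "homeomorphic_maps (euclidean :: double_arrow topology) euclidean f g"
    using fg by (simp add: homeomorphic_maps_def homeomorphism_def)
  then have "homeomorphic_map (Sc euclidean) (Sc euclidean) ((`) f)"
    using homeomorphic_maps_Sc homeomorphic_map_maps by blast
  ultimately show "\<exists>h. homeomorphic_map (Sc euclidean) (Sc euclidean) h \<and> h S = T"
    by blast
qed

end
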